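(* Let $\varphi_1$ be a Jacob's ladder, let $k_0\in\mathbb{N}$ be fixed, let $1\le k\le k_0$, and let $\Delta\in\mathbb{R}$ be fixed. Let $U_0=U_0(T)>0$ satisfy $U_0=o\left(\frac{T}{\ln T}\right)$ as $T\to\infty$. Then there is $\bar T_0>0$ such that for all $T\ge \bar T_0$ and all $U\in(0,U_0)$ the $\mathcal{Z}_{\zeta,Q^2}$-transformation of the function $f(t)=t^\Delta$, $t\in[T,T+U]$, is the constant $1$. That is, for all points $\alpha_0,\alpha_1,\dots,\alpha_k$ associated with $(T,U,k;f)$ and all points $\beta_1,\dots,\beta_k$ associated with $(T,U,k)$ (so that $\alpha_0\in(T,T+U)$) one has $$\prod_{r=1}^k\left|\frac{\zeta\left(\frac12+i\alpha_r\right)}{\zeta\left(\frac12+i\beta_r\right)}\right|^2=1+\mathcal{O}\left(\frac{\ln\ln T}{\ln T}\right),\qquad T\to\infty,$$ uniformly in $U\in(0,U_0)$, where the implied constant may depend on $\Delta$, $k_0$, $\varphi_1$ and the function $U_0$.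
   Context: $\zeta$ is the Riemann zeta-function and $Z(t)=e^{i\vartheta(t)}\zeta(\frac12+it)$ is Hardy's function, so $|Z(t)|=|\zeta(\frac12+it)|$. Jacob's ladder. Let $\mu$ be an admissible function: $\mu\in C^\infty([y_0,\infty))$ is increasing, unbounded, and $\mu(y)\ge 7y\ln y$. Let $y=\varphi(T)=\varphi(T;\mu)$ be the solution $x(T)=\varphi(T)$ of the nonlinear integral equation $$\int_0^{\mu[x(T)]}Z^2(t)e^{-\frac{2}{x(T)}t}\,dt=\int_0^TZ^2(t)\,dt .$$ The Jacob's ladder is $\varphi_1(t)=\frac12\varphi(t)$. For large $t$ it is a continuously differentiable strictly increasing function tending to infinity, with $t-\varphi_1(t)\sim(1-c)\frac{t}{\ln t}$ ($c$ is Euler's constant). Its derivative is denoted $\tilde Z^2(t)=\frac{d\varphi_1(t)}{dt}$ and satisfies $$\tilde Z^2(t)=\frac{|\zeta(\frac12+it)|^2}{\left\{1+\mathcal{O}\left(\frac{\ln\ln t}{\ln t}\right)\right\}\ln t},\qquad t\to\infty .$$ These are known properties of $\varphi_1$. Iterates. $\varphi_1^0(t)=t$, $\varphi_1^r=\varphi_1\circ\varphi_1^{r-1}$. For large $T$ and $r=0,1,\dots,k_0$, the reverse iterates are $\overset{r}{T}=\varphi_1^{-r}(T)$, i.e. $\overset{0}{T}=T$ and $\varphi_1(\overset{r}{T})=\overset{r-1}{T}$; similarly $(T+U)^{[r]}:=\varphi_1^{-r}(T+U)$. Associated points. Let $f$ be continuous on $[T,T+U]$, $0<U<U_0$. By the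 change of variables $t\mapsto\varphi_1^k(t)$ and the mean-value theorem there is $d\in(\overset{k}{T},(T+U)^{[k]})$ with $$\int_T^{T+U}f(t)\,dt=\int_{\overset{k}{T}}^{(T+U)^{[k]}}f[\varphi_1^k(t)]\prod_{r=0}^{k-1}\tilde Z^2[\varphi_1^r(t)]\,dt=\left((T+U)^{[k]}-\overset{k}{T}\right)f(\alpha_0)\prod_{r=1}^k\tilde Z^2(\alpha_r),$$ where $\alpha_r=\varphi_1^{k-r}(d)$, $r=0,1,\dots,k$. Any $\alpha_0,\dots,\alpha_k$ obtained from such a $d$ are called the points associated with $(T,U,k;f)$; one has $\alpha_0\in(T,T+U)$ and $\alpha_r\in(\overset{r}{T},(T+U)^{[r]})$. Points $\beta_1,\dots,\beta_k$ are associated with $(T,U,k)$ if they arise in the same way from $f\equiv1$: $\beta_r=\varphi_1^{k-r}(e)$, $r=1,\dots,k$, for some $e\in(\overset{k}{T},(T+U)^{[k]})$ with $U=\left((T+U)^{[k]}-\overset{k}{T}\right)\prod_{r=1}^k\tilde Z^2(\beta_r)$. The $\mathcal{Z}_{\zeta,Q^2}$-transformation. The $\mathcal{Z}_{\zeta,Q^2}$-transformation of $f(t)$, $t\in[T,T+U]$, $U\in(0,U_0)$, is said to be $g=g[T,U,\alpha_0(T,U,k;f)]$, $U\in(0,U_0)$, $\alpha_0\in(T,T+U)$, if $$\prod_{r=1}^k\left|\frac{\zeta(\frac12+i\alpha_r)}{\zeta(\frac12+i\beta_r)}\right|^2=\left\{1+\mathcal{O}\left(\frac{\ln\ln T}{\ln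 T}\right)\right\}g,\qquad T\to\infty .$$ *)

theory Defs
  imports "HOL-Complex_Analysis.Complex_Analysis" "HOL-Library.Landau_Symbols"
begin

section \<open>The Riemann zeta-function\<close>

text \<open>
  With \<open>N = n + 1\<close>, the \<open>n\<close>-th summand is \<open>N powr (- s)\<close> minus the integral of
  \<open>x powr (- s)\<close> over \<open>[N, N + 1]\<close>. The sum converges locally uniformly for \<open>Re s > 0\<close>;
  for \<open>Re s > 1\<close> the integrals add up to \<open>1 / (s - 1)\<close>.
  The function is the analytic continuation of the Dirichlet series to
  the half-plane \<open>Re s > 0\<close> (without \<open>s = 1\<close>), which contains the critical line:
  see \<open>riemann_zeta_holomorphic\<close>, \<open>riemann_zeta_sums\<close> and
  \<open>riemann_zeta_unique\<close> below. Values with \<open>Re s \<le> 0\<close> are not meaningful.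
\<close>

definition zeta_term :: "nat \<Rightarrow> complex \<Rightarrow> complex" where
  "zeta_term n s =
     of_nat (n + 1) powr (- s)
     - (of_nat (n + 2) powr (1 - s) - of_nat (n + 1) powr (1 - s)) / (1 - s)"

definition riemann_zeta :: "complex \<Rightarrow> complex" where
  "riemann_zeta s = 1 / (s - 1) + (\<Sum>n. zeta_term n s)"

lemma norm_zeta_term_le:
  assumes "Re s > 0" "s \<noteq> 1"
  shows "norm (zeta_term n s) \<le> norm s * real (n + 1) powr (- Re s - 1)"
proof -
  define a :: complex where "a = of_nat (n + 1)"
  define b :: complex where "b = of_nat (n + 2)"
  define B where "B = norm s * real (n + 1) powr (- Re s - 1)"
  define S where "S = closed_segment a b"
  have S: "\<exists>x. z = of_real x \<and> real (n + 1) \<le> x \<and> x \<le> real (n + 2)" if "z \<in> S" for z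
  proof -
    have "a = of_real (real (n + 1))" "b = of_real (real (n + 2))"
      by (simp_all add: a_def b_def)
    then have "z \<in> of_real ` closed_segment (real (n + 1)) (real (n + 2))"
      using that by (simp only: S_def closed_segment_of_real)
    then show ?thesis
      by (auto simp: closed_segment_eq_real_ivl)
  qed
  have slit: "z \<notin> \<real>\<^sub>\<le>\<^sub>0" if "z \<in> S" for z
    using S[OF that] by (auto simp: complex_nonpos_Reals_iff)
  have ab: "a \<in> S" "b \<in> S" and cvx: "convex S"
    by (auto simp: S_def)
  have nab: "norm (b - a) = 1"
    by (simp add: a_def b_def)
  have le1: "norm (z - a) \<le> 1" if z: "z \<in> S" for z
  proof -
    obtain x where x: "z = of_real x" "real (n + 1) \<le> x" "x \<le> real (n + 2)"
      using S[OF z] by blast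
    have "z - a = of_real (x - real (n + 1))"
      by (simp add: x a_def)
    then have "norm (z - a) = \<bar>x - real (n + 1)\<bar>"
      by (simp only: norm_of_real)
    with x show ?thesis by simp
  qed
  have B0: "B \<ge> 0" by (simp add: B_def)
  have 1: "norm (a powr (- s) - z powr (- s)) \<le> B" if z: "z \<in> S" for z
  proof -
    have "norm (z powr (- s) - a powr (- s)) \<le> B * norm (z - a)"
    proof (rule field_differentiable_bound[OF cvx _ _ z ab(1)])
      fix w assume w: "w \<in> S"
      show "((\<lambda>w. w powr (- s)) has_field_derivative (- s) * w powr (- s - 1)) (at w within S)"
        using has_field_derivative_powr[OF slit[OF w], of "- s"]
        by (rule has_field_derivative_at_within)
      obtain x where x: "w = of_real x" "real (n + 1) \<le> x"
        using S[OF w] by blast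
      have "norm (w powr (- s - 1)) = x powr (- Re s - 1)"
        using x by (subst norm_powr_real_powr) auto
      also have "\<dots> \<le> real (n + 1) powr (- Re s - 1)"
        using x assms by (intro powr_mono2') auto
      finally show "norm ((- s) * w powr (- s - 1)) \<le> B"
        by (simp add: B_def norm_mult mult_left_mono)
    qed
    also have "\<dots> \<le> B * 1"
      using le1[OF z] B0 by (rule mult_left_mono)
    finally show ?thesis by (simp add: norm_minus_commute)
  qed
  define f where "f = (\<lambda>z. z * a powr (- s) - z powr (1 - s) / (1 - s))"
  have "norm (f b - f a) \<le> B * norm (b - a)"
  proof (rule field_differentiable_bound[OF cvx _ _ ab(2,1)])
    fix z assume z: "z \<in> S"
    show "(f has_field_derivative a powr (- s) - z powr (- s)) (at z within S)"
      unfolding f_def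
      using assms slit[OF z]
      by (auto intro!: derivative_eq_intros
            has_field_derivative_at_within[OF has_field_derivative_powr])
    show "norm (a powr (- s) - z powr (- s)) \<le> B"
      by (rule 1[OF z])
  qed
  moreover have "f b - f a = zeta_term n s"
    by (simp add: f_def zeta_term_def a_def b_def diff_divide_distrib algebra_simps)
  ultimately show ?thesis
    by (simp add: nab B_def)
qed

lemma uniform_limit_zeta_term:
  assumes "z \<in> {s. Re s > 0} - {1}"
  shows "\<exists>d>0. cball z d \<subseteq> {s. Re s > 0} - {1} \<and>
           uniform_limit (cball z d) (\<lambda>m s. \<Sum>n<m. zeta_term n s) (\<lambda>s. \<Sum>n. zeta_term n s)
             sequentially"
proof -
  have "open ({s. Re s > 0} - {1})"
    by (intro open_Diff open_halfspace_Re_gt) auto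
  then obtain e where e: "e > 0" "cball z e \<subseteq> {s. Re s > 0} - {1}"
    using assms open_contains_cball_eq by blast
  define d where "d = min e (Re z / 2)"
  have d: "d > 0" using e assms by (auto simp: d_def)
  have sub: "cball z d \<subseteq> {s. Re s > 0} - {1}"
    using e by (auto simp: d_def)
  define M where "M = (\<lambda>n. (norm z + d) * real (n + 1) powr (- Re z / 2 - 1))"
  have "summable M"
    unfolding M_def
  proof (rule summable_mult)
    have "summable (\<lambda>n. real n powr (- Re z / 2 - 1))"
      using assms by (subst summable_real_powr_iff) auto
    then show "summable (\<lambda>n. real (n + 1) powr (- Re z / 2 - 1))"
      by (subst summable_iff_shift)
  qed
  moreover have "norm (zeta_term n s) \<le> M n" if s: "s \<in> cball z d" for n s
  proof -
    have "norm (zeta_term n s) \<le> norm s * real (n + 1) powr (- Re s - 1)"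
      using s sub by (intro norm_zeta_term_le) auto
    also have "\<dots> \<le> M n"
      unfolding M_def
    proof (rule mult_mono)
      have "norm (s - z) \<le> d"
        using s by (simp add: dist_norm norm_minus_commute)
      then show "norm s \<le> norm z + d"
        using norm_triangle_ineq2[of s z] by linarith
      have "\<bar>Re (s - z)\<bar> \<le> d"
        using \<open>norm (s - z) \<le> d\<close> abs_Re_le_cmod[of "s - z"] by linarith
      moreover have "d \<le> Re z / 2"
        by (simp add: d_def)
      ultimately have "Re s \<ge> Re z / 2"
        unfolding minus_complex.simps by linarith
      then show "real (n + 1) powr (- Re s - 1) \<le> real (n + 1) powr (- Re z / 2 - 1)"
        by (intro powr_mono) auto
    qed (use d in auto)
    finally show ?thesis .
  qed
  ultimately have "uniform_limit (cball z d) (\<lambda>m s. \<Sum>n<m. zeta_term n s)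
                     (\<lambda>s. \<Sum>n. zeta_term n s) sequentially"
    by (intro Weierstrass_m_test) auto
  with d sub show ?thesis by blast
qed

lemma riemann_zeta_holomorphic:
  "riemann_zeta holomorphic_on ({s. Re s > 0} - {1})"
proof -
  have op: "open ({s. Re s > 0} - {1})"
    by (intro open_Diff open_halfspace_Re_gt) auto
  have "(\<lambda>s. \<Sum>n. zeta_term n s) holomorphic_on ({s. Re s > 0} - {1})"
  proof (rule holomorphic_uniform_sequence[OF op _ uniform_limit_zeta_term])
    show "(\<lambda>s. \<Sum>n<m. zeta_term n s) holomorphic_on ({s. Re s > 0} - {1})" for m
      unfolding zeta_term_def by (intro holomorphic_intros) auto
  qed
  then show ?thesis
    unfolding riemann_zeta_def by (intro holomorphic_intros) auto
qed

lemma riemann_zeta_sums: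
  assumes "Re s > 1"
  shows "(\<lambda>n. 1 / of_nat (n + 1) powr s) sums riemann_zeta s"
proof -
  have s: "Re s > 0" "s \<noteq> 1" using assms by auto
  have lim: "(\<lambda>n. of_nat (n + 1) powr (1 - s)) \<longlonglongrightarrow> 0"
  proof (rule tendsto_norm_zero_cancel)
    have "(\<lambda>n. real (n + 1) powr (1 - Re s)) \<longlonglongrightarrow> 0"
    proof (rule tendsto_neg_powr)
      show "filterlim (\<lambda>n. real (n + 1)) at_top sequentially"
        by (rule filterlim_compose[OF filterlim_real_sequentially filterlim_add_const_nat_at_top])
    qed (use assms in auto)
    also have "(\<lambda>n. real (n + 1) powr (1 - Re s)) = (\<lambda>n. norm (of_nat (n + 1) powr (1 - s)))"
      by (subst norm_powr_real_powr) auto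
    finally show "(\<lambda>n. norm (of_nat (n + 1) powr (1 - s))) \<longlonglongrightarrow> 0" .
  qed
  have "(\<lambda>n. of_nat (Suc n + 1) powr (1 - s) - of_nat (n + 1) powr (1 - s))
          sums (0 - of_nat (0 + 1) powr (1 - s))"
    using telescope_sums[OF lim] by simp
  then have "(\<lambda>n. (of_nat (n + 2) powr (1 - s) - of_nat (n + 1) powr (1 - s)) / (1 - s))
          sums ((0 - 1) / (1 - s))"
    by (intro sums_divide) (simp add: add.commute)
  moreover have "(\<lambda>n. zeta_term n s) sums (\<Sum>n. zeta_term n s)"
  proof -
    from uniform_limit_zeta_term[of s] s obtain d where
      "d > 0" "uniform_limit (cball s d) (\<lambda>m s. \<Sum>n<m. zeta_term n s)
                 (\<lambda>s. \<Sum>n. zeta_term n s) sequentially"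
      by auto
    then show ?thesis
      unfolding sums_def by (elim tendsto_uniform_limitI) auto
  qed
  ultimately have "(\<lambda>n. (of_nat (n + 2) powr (1 - s) - of_nat (n + 1) powr (1 - s)) / (1 - s)
       + zeta_term n s) sums ((0 - 1) / (1 - s) + (\<Sum>n. zeta_term n s))"
    by (rule sums_add)
  also have "(0 - 1) / (1 - s) + (\<Sum>n. zeta_term n s) = riemann_zeta s"
    using s by (simp add: riemann_zeta_def divide_simps) (simp add: algebra_simps)
  finally show ?thesis
    by (simp add: zeta_term_def powr_minus divide_inverse)
qed

lemma riemann_zeta_unique:
  assumes "f holomorphic_on ({s. Re s > 0} - {1})"
    and "\<And>s. Re s > 1 \<Longrightarrow> (\<lambda>n. 1 / of_nat (n + 1) powr s) sums f s"
    and "Re s > 0" "s \<noteq> 1"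
  shows "f s = riemann_zeta s"
proof (rule analytic_continuation_open[of "{s. Re s > 1}" "{s. Re s > 0} - {1}" f riemann_zeta])
  show "connected ({s. Re s > 0} - {1})"
    by (intro connected_open_delete open_halfspace_Re_gt convex_connected convex_halfspace_Re_gt)
       simp
  show "{s. Re s > 1} \<noteq> {}"
    by (auto intro: exI[of _ 2])
  show "f z = riemann_zeta z" if "z \<in> {s. Re s > 1}" for z
    using assms(2)[of z] riemann_zeta_sums[of z] that by (auto dest: sums_unique2)
qed (use assms riemann_zeta_holomorphic in
      \<open>auto intro!: open_Diff open_halfspace_Re_gt\<close>)


section \<open>Hardy's function\<close>

text \<open>
  \<open>riemann_siegel_theta t = Im (ln \<Gamma>(1/4 + i t/2)) - (t/2) ln \<pi>\<close>, where \<open>ln_Gamma\<close> is the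
  branch that is continuous off the negative real axis. Hardy's function is typed as complex;
  its values are real, so its square is \<open>(cmod (hardy_Z t))\<^sup>2\<close>.
\<close>

definition riemann_siegel_theta :: "real \<Rightarrow> real" where
  "riemann_siegel_theta t = Im (ln_Gamma (Complex (1/4) (t/2))) - t / 2 * ln pi"

definition hardy_Z :: "real \<Rightarrow> complex" where
  "hardy_Z t = cis (riemann_siegel_theta t) * riemann_zeta (Complex (1/2) t)"

lemma cmod_hardy_Z: "cmod (hardy_Z t) = cmod (riemann_zeta (Complex (1/2) t))"
  by (simp add: hardy_Z_def norm_mult)


section \<open>Jacob's ladders\<close>

text \<open>
  \<open>D n\<close> is the \<open>n\<close>-th derivative of \<open>\<mu>\<close> on \<open>[y0, \<infinity>)\<close>, one-sided at \<open>y0\<close>.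
\<close>

definition admissible :: "real \<Rightarrow> (real \<Rightarrow> real) \<Rightarrow> bool" where
  "admissible y0 \<mu> \<longleftrightarrow>
     y0 > 0 \<and>
     (\<exists>D :: nat \<Rightarrow> real \<Rightarrow> real. D 0 = \<mu> \<and>
        (\<forall>n. \<forall>y\<ge>y0. (D n has_real_derivative D (Suc n) y) (at y within {y0..}))) \<and>
     mono_on {y0..} \<mu> \<and>
     \<not> bdd_above (\<mu> ` {y0..}) \<and>
     (\<forall>y\<ge>y0. \<mu> y \<ge> 7 * y * ln y)"

text \<open>
  The integral equation need only be solvable for large \<open>T\<close>; \<open>T0\<close> is a point from which on
  the ladder is considered. Its values at arguments \<open>\<le> T0\<close> are irrelevant.
\<close>

definition jacobs_ladder :: "real \<Rightarrow> (real \<Rightarrow> real) \<Rightarrow> bool" where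
  "jacobs_ladder T0 \<phi>1 \<longleftrightarrow>
     (\<exists>y0 \<mu> \<phi>. admissible y0 \<mu> \<and>
        (\<forall>T>T0. \<phi> T \<ge> y0 \<and>
           integral {0..\<mu> (\<phi> T)} (\<lambda>t. (cmod (hardy_Z t))\<^sup>2 * exp (- (2 / \<phi> T) * t))
             = integral {0..T} (\<lambda>t. (cmod (hardy_Z t))\<^sup>2)) \<and>
        (\<forall>T>T0. \<phi>1 T = \<phi> T / 2))"

text \<open>
  The \<open>r\<close>-th reverse iterate \<open>\<phi>1\<^sup>-\<^sup>r(T)\<close>. The inverse is taken on \<open>(T0, \<infinity>)\<close>, where \<open>\<phi>1\<close> is
  injective; the value is meaningful for all large \<open>T\<close>, which then lie in the range.
\<close>

definition rev_iter :: "real \<Rightarrow> (real \<Rightarrow> real) \<Rightarrow> nat \<Rightarrow> real \<Rightarrow> real" where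
  "rev_iter T0 \<phi>1 r T = (inv_into {T0<..} \<phi>1 ^^ r) T"


section \<open>Associated points and the transformation\<close>

definition associated_points ::
  "real \<Rightarrow> (real \<Rightarrow> real) \<Rightarrow> real \<Rightarrow> real \<Rightarrow> nat \<Rightarrow> (real \<Rightarrow> real) \<Rightarrow> (nat \<Rightarrow> real) \<Rightarrow> bool" where
  "associated_points T0 \<phi>1 T U k f \<alpha> \<longleftrightarrow>
     continuous_on {T..T + U} f \<and>
     (\<exists>d. rev_iter T0 \<phi>1 k T < d \<and> d < rev_iter T0 \<phi>1 k (T + U) \<and>
        (\<forall>r\<in>{0..k}. \<alpha> r = (\<phi>1 ^^ (k - r)) d) \<and>
        integral {T..T + U} f =
          (rev_iter T0 \<phi>1 k (T + U) - rev_iter T0 \<phi>1 k T)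
            * f (\<alpha> 0) * (\<Prod>r=1..k. deriv \<phi>1 (\<alpha> r)))"

definition associated_points_one ::
  "real \<Rightarrow> (real \<Rightarrow> real) \<Rightarrow> real \<Rightarrow> real \<Rightarrow> nat \<Rightarrow> (nat \<Rightarrow> real) \<Rightarrow> bool" where
  "associated_points_one T0 \<phi>1 T U k \<beta> \<longleftrightarrow>
     (\<exists>e. rev_iter T0 \<phi>1 k T < e \<and> e < rev_iter T0 \<phi>1 k (T + U) \<and>
        (\<forall>r\<in>{1..k}. \<beta> r = (\<phi>1 ^^ (k - r)) e) \<and>
        U = (rev_iter T0 \<phi>1 k (T + U) - rev_iter T0 \<phi>1 k T)
              * (\<Prod>r=1..k. deriv \<phi>1 (\<beta> r)))"

text \<open>
  \<open>g\<close> is the transformation of \<open>f\<close> on \<open>[T, T + U]\<close> up to a factor \<open>1 + \<epsilon>\<close> with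
  \<open>\<bar>\<epsilon>\<bar> \<le> \<delta>\<close>. The \<open>O\<close>-term is obtained by letting \<open>\<delta>\<close> be a constant multiple of
  \<open>ln (ln T) / ln T\<close>.
\<close>

definition Z_zeta_Q2_transformation ::
  "real \<Rightarrow> (real \<Rightarrow> real) \<Rightarrow> real \<Rightarrow> real \<Rightarrow> real \<Rightarrow> nat \<Rightarrow> (real \<Rightarrow> real) \<Rightarrow> (real \<Rightarrow> real) \<Rightarrow> bool"
  where
  "Z_zeta_Q2_transformation T0 \<phi>1 \<delta> T U k f g \<longleftrightarrow>
     (\<forall>\<alpha> \<beta>. associated_points T0 \<phi>1 T U k f \<alpha> \<longrightarrow>
        associated_points_one T0 \<phi>1 T U k \<beta> \<longrightarrow>
        \<alpha> 0 \<in> {T<..<T + U} \<and>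
        (\<exists>\<epsilon>. \<bar>\<epsilon>\<bar> \<le> \<delta> \<and>
           (\<Prod>r=1..k. (cmod (riemann_zeta (Complex (1/2) (\<alpha> r))
                           / riemann_zeta (Complex (1/2) (\<beta> r))))\<^sup>2)
             = (1 + \<epsilon>) * g (\<alpha> 0)))"

end

theory Submission
  imports Defs "HOL-Real_Asymp.Real_Asymp"
begin

text \<open>
  The length of \<open>(\<phi>\<^sub>1\<^sup>-\<^sup>k(T), \<phi>\<^sub>1\<^sup>-\<^sup>k(T + U))\<close> is a common factor of the equations
  that define the \<open>\<alpha>\<^sub>r\<close> and the \<open>\<beta>\<^sub>r\<close>. Dividing the equations cancels it and leaves
  (\<open>associated_products_quotient\<close>)
  \<open>\<Prod>\<^sub>r \<phi>\<^sub>1'(\<alpha>\<^sub>r) / \<phi>\<^sub>1'(\<beta>\<^sub>r) = P\<close>, where \<open>P\<close> is the mean value of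
  \<open>(t / \<alpha>\<^sub>0) powr \<Delta>\<close> over \<open>[T, T + U]\<close>. Both \<open>t\<close> and \<open>\<alpha>\<^sub>0\<close> lie in an interval that
  is short relative to \<open>T\<close>, so \<open>ln P = O(U / T) = O(1 / ln T)\<close>
  (\<open>abs_ln_mean_powr_le\<close>): the power function is constant to the required precision,
  whatever the exponent.

  It remains to replace \<open>\<phi>\<^sub>1'(t)\<close> by \<open>\<bar>\<zeta>(1/2 + it)\<bar>\<^sup>2 = w(t) \<phi>\<^sub>1'(t)\<close> with
  \<open>w(t) = (1 + \<eta>(t)) ln t\<close>, which costs a factor \<open>w(\<alpha>\<^sub>r) / w(\<beta>\<^sub>r)\<close> for each \<open>r\<close>.
  Since \<open>t / 2 \<le> \<phi>\<^sub>1(t) \<le> t\<close> for large \<open>t\<close>, all of these points lie in \<open>[T, A T]\<close> for a constant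
  \<open>A\<close> (\<open>associated_point_bounds\<close>). There \<open>\<eta> = O(ln ln T / ln T)\<close> and \<open>ln ln\<close> varies by at
  most \<open>ln A / ln T\<close>, so \<open>ln (w(\<alpha>\<^sub>r) / w(\<beta>\<^sub>r)) = O(ln ln T / ln T)\<close>
  (\<open>quotient_of_ladder_weights\<close>).

  All errors are measured by logarithms, which turns the product over \<open>r\<close> into a sum of
  at most \<open>k0\<close> terms and makes the constant explicit.
\<close>

section \<open>Factors close to one\<close>

lemma abs_minus_one_le_of_abs_ln_le:
  fixes F x :: real
  assumes "F > 0" "\<bar>ln F\<bar> \<le> x" "x \<le> 1"
  shows "\<bar>F - 1\<bar> \<le> 2 * x"
proof (cases "ln F \<ge> 0")
  case True
  have "exp (ln F) \<le> 1 + ln F + (ln F)\<^sup>2"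
    using True assms by (intro exp_bound) auto
  moreover have "(ln F)\<^sup>2 \<le> ln F"
    using True assms by (auto simp: power2_eq_square intro!: mult_left_le)
  moreover have "F \<ge> 1"
    using True assms by simp
  ultimately show ?thesis
    using assms True by simp
next
  case False
  have "1 + ln F \<le> exp (ln F)"
    by (rule exp_ge_add_one_self)
  moreover have "F \<le> 1"
    using False assms by simp
  ultimately show ?thesis
    using False assms by simp
qed

lemma abs_ln_one_plus_le:
  fixes x :: real
  assumes "\<bar>x\<bar> \<le> 1/2"
  shows "\<bar>ln (1 + x)\<bar> \<le> 2 * \<bar>x\<bar>"
proof -
  have up: "ln (1 + x) \<le> x"
    using assms by (intro ln_add_one_self_le_self2) auto
  have "- ln (1 + x) = ln (1 + (- x / (1 + x)))"
    using assms by (subst ln_inverse[symmetric]) (auto simp: field_simps)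
  also have "\<dots> \<le> - x / (1 + x)"
    using assms by (intro ln_add_one_self_le_self2) (auto simp: field_simps)
  also have "\<dots> \<le> \<bar>x\<bar> / (1 / 2)"
    using assms by (intro frac_le) auto
  finally show ?thesis
    using up by simp
qed

text \<open>
  Multiplying \<open>T\<close> by \<open>A\<close> multiplies \<open>ln T\<close> by \<open>1 + ln A / ln T\<close>, and \<open>ln (1 + u) \<le> u\<close>.
\<close>

lemma abs_ln_ln_diff_le:
  fixes A T x y :: real
  assumes T: "T > 1" and x: "x \<in> {T..A * T}" and y: "y \<in> {T..A * T}"
  shows "\<bar>ln (ln x) - ln (ln y)\<bar> \<le> ln A / ln T"
proof -
  have "T \<le> A * T"
    using x unfolding atLeastAtMost_iff by linarith
  then have A: "A \<ge> 1"
    using T by simp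
  have 1: "ln (ln T) \<le> ln (ln z) \<and> ln (ln z) \<le> ln (ln T) + ln A / ln T"
    if z: "z \<in> {T..A * T}" for z
  proof
    show "ln (ln T) \<le> ln (ln z)"
      using T z by simp
    have "ln (ln z) \<le> ln (ln (A * T))"
      using T z by simp
    also have "ln (A * T) = ln T * (1 + ln A / ln T)"
      using T A by (simp add: ln_mult field_simps)
    also have "ln \<dots> = ln (ln T) + ln (1 + ln A / ln T)"
      using T A by (intro ln_mult_pos add_pos_nonneg) auto
    also have "ln (1 + ln A / ln T) \<le> ln A / ln T"
      using T A by (intro ln_add_one_self_le_self) auto
    finally show "ln (ln z) \<le> ln (ln T) + ln A / ln T"
      by simp
  qed
  show ?thesis
    using 1[OF x] 1[OF y] by linarith
qed

text \<open>
  \<open>P\<close> is the mean value of \<open>(t / a) powr \<Delta>\<close> over \<open>[T, T + U]\<close>, and on this interval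
  \<open>\<bar>ln (t / a)\<bar> \<le> ln (1 + U / T) \<le> U / T\<close>.
\<close>

lemma abs_ln_mean_powr_le:
  fixes T U a \<Delta> :: real
  defines "P \<equiv> integral {T..T + U} (\<lambda>t. t powr \<Delta>) / (U * a powr \<Delta>)"
  assumes T: "T > 0" and U: "U > 0" and a: "a \<in> {T..T + U}"
  shows "P > 0" "\<bar>ln P\<bar> \<le> \<bar>\<Delta>\<bar> * (U / T)"
proof -
  define q where "q = \<bar>\<Delta>\<bar> * (U / T)"
  have cont: "continuous_on {T..T + U} (\<lambda>t. t powr \<Delta>)"
    using T by (intro continuous_intros) auto
  have int: "(\<lambda>t. t powr \<Delta>) integrable_on {T..T + U}"
    using cont by (rule integrable_continuous_real)
  have bd: "exp (- q) * a powr \<Delta> \<le> t powr \<Delta> \<and> t powr \<Delta> \<le> exp q * a powr \<Delta>"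
    if t: "t \<in> {T..T + U}" for t
  proof -
    have l: "ln T \<le> ln z \<and> ln z \<le> ln T + U / T" if "z \<in> {T..T + U}" for z
    proof
      show "ln T \<le> ln z"
        using T that by simp
      have "ln z \<le> ln (T * (1 + U / T))"
        using T that by (simp add: distrib_left)
      also have "\<dots> = ln T + ln (1 + U / T)"
        using T U by (intro ln_mult_pos add_pos_pos) auto
      also have "ln (1 + U / T) \<le> U / T"
        using T U by (intro ln_add_one_self_le_self) auto
      finally show "ln z \<le> ln T + U / T"
        by simp
    qed
    have "\<bar>ln t - ln a\<bar> \<le> U / T"
      using l[OF t] l[OF a] by linarith
    then have "\<bar>\<Delta> * (ln t - ln a)\<bar> \<le> q"
      unfolding q_def abs_mult by (intro mult_left_mono) auto
    then have "- q + \<Delta> * ln a \<le> \<Delta> * ln t \<and> \<Delta> * ln t \<le> q + \<Delta> * ln a"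
      by (auto simp: algebra_simps abs_le_iff)
    moreover have "t powr \<Delta> = exp (\<Delta> * ln t)" "a powr \<Delta> = exp (\<Delta> * ln a)"
      using T t a by (auto simp: powr_def)
    ultimately show ?thesis
      by (simp flip: exp_add)
  qed
  have "integral {T..T + U} (\<lambda>t. exp (- q) * a powr \<Delta>) \<le> integral {T..T + U} (\<lambda>t. t powr \<Delta>)"
    using bd by (intro integral_le int) auto
  moreover have "integral {T..T + U} (\<lambda>t. t powr \<Delta>) \<le> integral {T..T + U} (\<lambda>t. exp q * a powr \<Delta>)"
    using bd by (intro integral_le int) auto
  moreover have "U * a powr \<Delta> > 0"
    using T U a by auto
  ultimately have lo: "exp (- q) \<le> P" and hi: "P \<le> exp q"
    using U unfolding P_def by (simp_all add: pos_le_divide_eq pos_divide_le_eq mult_ac)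
  show "P > 0"
    using lo exp_gt_zero[of "- q"] by linarith
  then have "- q \<le> ln P" "ln P \<le> q"
    using lo hi by (metis exp_le_cancel_iff exp_ln)+
  then show "\<bar>ln P\<bar> \<le> \<bar>\<Delta>\<bar> * (U / T)"
    by (simp add: q_def)
qed


section \<open>Reverse iterates\<close>

text \<open>
  These properties of a ladder suffice to locate associated points. Because of
  \<open>\<phi> t \<le> t\<close> the half-line \<open>[S, \<infinity>)\<close> is closed under inverse images, so that reverse iterates
  of all orders exist for every \<open>y \<ge> S\<close>. The bound \<open>t / 2 \<le> \<phi> t\<close> keeps the \<open>r\<close>-th reverse
  iterate within a factor \<open>2 ^ r\<close>.
\<close>

locale reverse_ladder =
  fixes T0 S :: real and \<phi> :: "real \<Rightarrow> real"
  assumes S: "T0 < S" "0 < S"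
    and cont: "continuous_on {T0<..} \<phi>"
    and mono: "strict_mono_on {T0<..} \<phi>"
    and at_top: "filterlim \<phi> at_top at_top"
    and half_le: "\<And>t. t \<ge> S \<Longrightarrow> t / 2 \<le> \<phi> t"
    and le_self: "\<And>t. t \<ge> S \<Longrightarrow> \<phi> t \<le> t"
begin

abbreviation \<psi> :: "real \<Rightarrow> real" where
  "\<psi> \<equiv> inv_into {T0<..} \<phi>"

text \<open>
  Injectivity on all of \<open>{T0<..}\<close> makes the chosen preimage the one found in \<open>[S, \<infinity>)\<close> by the
  intermediate value theorem.
\<close>

lemma preimage:
  assumes "y \<ge> S"
  shows "\<phi> (\<psi> y) = y" "y \<le> \<psi> y" "\<psi> y \<le> 2 * y"
proof -
  obtain b where b: "b \<ge> S" "\<phi> b \<ge> y"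
    using at_top unfolding filterlim_at_top eventually_at_top_linorder
    by (metis linear)
  have "\<phi> S \<le> y"
    using le_self[of S] assms by simp
  moreover have "continuous_on {S..b} \<phi>"
    using S by (intro continuous_on_subset[OF cont]) auto
  ultimately obtain x where x: "S \<le> x" "x \<le> b" "\<phi> x = y"
    using IVT'[of \<phi> S y b] b by blast
  have "\<psi> y = x"
    using x S strict_mono_on_imp_inj_on[OF mono] inv_into_f_f[of \<phi> "{T0<..}" x] by auto
  with x show "\<phi> (\<psi> y) = y" "y \<le> \<psi> y" "\<psi> y \<le> 2 * y"
    using le_self[of x] half_le[of x] by auto
qed

lemma iterated_preimage:
  assumes "y \<ge> S"
  shows "y \<le> rev_iter T0 \<phi> r y" "rev_iter T0 \<phi> r y \<le> 2 ^ r * y"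
proof -
  have "y \<le> (\<psi> ^^ r) y \<and> (\<psi> ^^ r) y \<le> 2 ^ r * y"
  proof (induction r)
    case (Suc r)
    then show ?case
      using preimage(2,3)[of "(\<psi> ^^ r) y"] assms by (auto simp: mult.assoc)
  qed simp
  then show "y \<le> rev_iter T0 \<phi> r y" "rev_iter T0 \<phi> r y \<le> 2 ^ r * y"
    by (simp_all add: rev_iter_def)
qed

lemma ladder_rev_iter_Suc:
  assumes "y \<ge> S"
  shows "\<phi> (rev_iter T0 \<phi> (Suc r) y) = rev_iter T0 \<phi> r y"
  using preimage(1)[of "rev_iter T0 \<phi> r y"] iterated_preimage(1)[of y r] assms
  by (simp add: rev_iter_def)

text \<open>
  The ladder is increasing and maps reverse iterates of order \<open>r + 1\<close> to those of order \<open>r\<close>;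
  the proof descends from \<open>k\<close> to \<open>r\<close>.
\<close>

lemma iterate_between:
  assumes "S \<le> a" "S \<le> b" "rev_iter T0 \<phi> k a < d" "d < rev_iter T0 \<phi> k b" "r \<le> k"
  shows "rev_iter T0 \<phi> r a < (\<phi> ^^ (k - r)) d \<and> (\<phi> ^^ (k - r)) d < rev_iter T0 \<phi> r b"
  using \<open>r \<le> k\<close>
proof (induction r rule: inc_induct)
  case base
  then show ?case
    using assms by simp
next
  case (step r)
  define x where "x = (\<phi> ^^ (k - Suc r)) d"
  have "(\<phi> ^^ (k - r)) d = \<phi> x"
    using step.hyps by (simp add: x_def Suc_diff_Suc flip: funpow.simps(2) o_apply[of \<phi>])
  moreover have "S \<le> rev_iter T0 \<phi> (Suc r) a" "rev_iter T0 \<phi> (Suc r) a < x"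
    "x < rev_iter T0 \<phi> (Suc r) b"
    using step.IH iterated_preimage(1)[of a "Suc r"] assms by (auto simp: x_def)
  ultimately show ?case
    using S ladder_rev_iter_Suc[of a r] ladder_rev_iter_Suc[of b r] assms
      strict_mono_onD[OF mono, of "rev_iter T0 \<phi> (Suc r) a" x]
      strict_mono_onD[OF mono, of x "rev_iter T0 \<phi> (Suc r) b"]
    by auto
qed

text \<open>
  The two-sided bound with a factor that depends only on the maximal order \<open>m\<close> is what makes
  the final estimates uniform in \<open>U\<close> and \<open>k\<close>.
\<close>

lemma associated_point_bounds:
  assumes "S \<le> T" "0 < U" "U \<le> T" "k \<le> m"
    and "rev_iter T0 \<phi> k T < d" "d < rev_iter T0 \<phi> k (T + U)" "r \<le> k"
  shows "(\<phi> ^^ (k - r)) d \<in> {T..2 ^ Suc m * T}"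
proof -
  define x where "x = (\<phi> ^^ (k - r)) d"
  have "rev_iter T0 \<phi> r T < x" "x < rev_iter T0 \<phi> r (T + U)"
    using iterate_between[of T "T + U" k d r] assms by (auto simp: x_def)
  moreover have "T \<le> rev_iter T0 \<phi> r T" "rev_iter T0 \<phi> r (T + U) \<le> 2 ^ r * (T + U)"
    using assms by (auto intro!: iterated_preimage)
  moreover have "(2::real) ^ r * (T + U) \<le> 2 ^ m * (2 * T)"
    using assms S by (intro mult_mono power_increasing) auto
  ultimately show ?thesis
    by (simp add: x_def)
qed

end

text \<open>
  The asymptotic formula for \<open>t - \<phi> t\<close> gives both bounds: its right-hand side is positive
  because Euler's constant is less than \<open>1\<close>, and it is \<open>o(t)\<close>.
\<close>

lemma reverse_ladder_eventually:
  fixes \<phi> :: "real \<Rightarrow> real"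
  assumes "\<phi> C1_differentiable_on {T0<..}" "strict_mono_on {T0<..} \<phi>"
    and "filterlim \<phi> at_top at_top"
    and diff: "(\<lambda>t. t - \<phi> t) \<sim>[at_top] (\<lambda>t. (1 - euler_mascheroni) * (t / ln t))"
  shows "\<forall>\<^sub>F S in at_top. reverse_ladder T0 S \<phi>"
proof -
  have e: "(euler_mascheroni :: real) < 1"
    using euler_mascheroni_less_13_over_22 by simp
  have "\<forall>\<^sub>F t in at_top. sgn (t - \<phi> t) = sgn ((1 - euler_mascheroni) * (t / ln t))"
    using diff by (rule asymp_equiv_eventually_same_sign)
  then have 1: "\<forall>\<^sub>F t in at_top. \<phi> t \<le> t"
    using eventually_gt_at_top[of 1]
  proof eventually_elim
    case (elim t)
    have "(1 - euler_mascheroni) * (t / ln t) > 0"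
      using e elim by (intro mult_pos_pos divide_pos_pos) auto
    with elim have "sgn (t - \<phi> t) = 1"
      by (simp only: sgn_pos)
    then show ?case
      by (simp add: sgn_if split: if_splits)
  qed
  have "(\<lambda>t. t - \<phi> t) \<in> O[at_top](\<lambda>t. (1 - euler_mascheroni) * (t / ln t))"
    using diff by (rule asymp_equiv_imp_bigo)
  also have "(\<lambda>t::real. (1 - euler_mascheroni) * (t / ln t)) \<in> o[at_top](\<lambda>t. t)"
  proof -
    have "(\<lambda>t::real. t / ln t) \<in> o[at_top](\<lambda>t. t)"
      by real_asymp
    then show ?thesis
      using e by (subst landau_o.small.cmult_in_iff) auto
  qed
  finally have "\<forall>\<^sub>F t in at_top. norm (t - \<phi> t) \<le> 1 / 2 * norm t"
    by (rule landau_o.smallD) simp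
  then have 2: "\<forall>\<^sub>F t in at_top. t / 2 \<le> \<phi> t"
    using eventually_gt_at_top[of 0] by eventually_elim (auto simp: abs_if split: if_splits)
  have 3: "\<forall>\<^sub>F S in at_top. \<forall>t\<ge>S. t / 2 \<le> \<phi> t \<and> \<phi> t \<le> t"
    by (rule eventually_all_ge_at_top) (use 1 2 in eventually_elim, auto)
  show ?thesis
    using 3 eventually_gt_at_top[of 0] eventually_gt_at_top[of T0]
    by eventually_elim
      (auto intro!: reverse_ladder.intro assms C1_differentiable_imp_continuous_on)
qed


section \<open>The transformation of powers\<close>

text \<open>
  The weight \<open>(1 + \<eta> t) * ln t\<close>, by which the derivative of a ladder has to be multiplied to
  give \<open>\<bar>\<zeta>(1/2 + it)\<bar>\<^sup>2\<close>, oscillates little over a range \<open>[T, A * T]\<close>.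
\<close>

lemma quotient_of_ladder_weights:
  fixes \<eta> :: "real \<Rightarrow> real" and T A \<kappa> x y :: real
  assumes T: "T > 1" and x: "x \<in> {T..A * T}" and y: "y \<in> {T..A * T}"
    and \<eta>: "\<bar>\<eta> x\<bar> \<le> \<kappa>" "\<bar>\<eta> y\<bar> \<le> \<kappa>" and \<kappa>: "\<kappa> \<le> 1/2"
  defines "q \<equiv> ((1 + \<eta> x) * ln x) / ((1 + \<eta> y) * ln y)"
  shows "q > 0" "\<bar>ln q\<bar> \<le> 4 * \<kappa> + ln A / ln T"
proof -
  have pos: "1 + \<eta> x > 0" "1 + \<eta> y > 0" "ln x > 0" "ln y > 0"
    using assms by auto
  then show "q > 0"
    by (simp add: q_def)
  have "ln q = (ln (1 + \<eta> x) - ln (1 + \<eta> y)) + (ln (ln x) - ln (ln y))"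
    unfolding q_def using pos by (simp add: ln_mult ln_div)
  moreover have "\<bar>ln (1 + \<eta> x)\<bar> \<le> 2 * \<kappa>" "\<bar>ln (1 + \<eta> y)\<bar> \<le> 2 * \<kappa>"
    using abs_ln_one_plus_le[of "\<eta> x"] abs_ln_one_plus_le[of "\<eta> y"] \<eta> \<kappa> by linarith+
  moreover have "\<bar>ln (ln x) - ln (ln y)\<bar> \<le> ln A / ln T"
    using T x y by (rule abs_ln_ln_diff_le)
  ultimately show "\<bar>ln q\<bar> \<le> 4 * \<kappa> + ln A / ln T"
    by linarith
qed

text \<open>
  The length of the interval between the reverse iterates occurs in both defining equations and
  cancels on division. It is nonzero since the second equation has \<open>U \<noteq> 0\<close> on its left.
\<close>

lemma associated_products_quotient:
  assumes \<alpha>: "associated_points T0 \<phi> T U k f \<alpha>"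
    and \<beta>: "associated_points_one T0 \<phi> T U k \<beta>"
    and U: "U \<noteq> 0" and f: "f (\<alpha> 0) \<noteq> 0"
  shows "(\<Prod>r=1..k. deriv \<phi> (\<alpha> r)) / (\<Prod>r=1..k. deriv \<phi> (\<beta> r))
           = integral {T..T + U} f / (U * f (\<alpha> 0))"
proof -
  define L where "L = rev_iter T0 \<phi> k (T + U) - rev_iter T0 \<phi> k T"
  have a: "integral {T..T + U} f = L * f (\<alpha> 0) * (\<Prod>r=1..k. deriv \<phi> (\<alpha> r))"
    using \<alpha> by (auto simp: associated_points_def L_def)
  have b: "U = L * (\<Prod>r=1..k. deriv \<phi> (\<beta> r))"
    using \<beta> by (auto simp: associated_points_one_def L_def)
  then have L: "L \<noteq> 0"
    using U by auto
  have "integral {T..T + U} f / (U * f (\<alpha> 0))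
      = (L * f (\<alpha> 0) * (\<Prod>r=1..k. deriv \<phi> (\<alpha> r))) /
        (L * (\<Prod>r=1..k. deriv \<phi> (\<beta> r)) * f (\<alpha> 0))"
    by (simp only: a flip: b)
  also have "\<dots> = (\<Prod>r=1..k. deriv \<phi> (\<alpha> r)) / (\<Prod>r=1..k. deriv \<phi> (\<beta> r))"
    using L f by simp
  finally show "(\<Prod>r=1..k. deriv \<phi> (\<alpha> r)) / (\<Prod>r=1..k. deriv \<phi> (\<beta> r))
           = integral {T..T + U} f / (U * f (\<alpha> 0))"
    by simp
qed

text \<open>
  The estimate for one triple \<open>T, U, k\<close>: the bound for \<open>x\<close> collects the logarithms of the mean
  value of the power function and of \<open>k\<close> quotients of weights, and the factor \<open>2\<close> in the
  conclusion is the cost of passing from \<open>ln F\<close> back to \<open>F - 1\<close>.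
\<close>

lemma (in reverse_ladder) Z_zeta_Q2_transformation_powr:
  fixes T U \<Delta> \<kappa> x :: real
  assumes deriv: "\<And>t. t \<ge> T \<Longrightarrow>
      deriv \<phi> t = (cmod (riemann_zeta (Complex (1/2) t)))\<^sup>2 / ((1 + \<eta> t) * ln t)"
    and \<eta>: "\<And>t. t \<ge> T \<Longrightarrow> \<bar>\<eta> t\<bar> \<le> \<kappa>" and \<kappa>: "\<kappa> \<le> 1/2"
    and T: "S \<le> T" "1 < T" and U: "0 < U" "U \<le> T" and k: "k \<le> m"
    and x: "\<bar>\<Delta>\<bar> * (U / T) + real k * (4 * \<kappa> + ln (2 ^ Suc m) / ln T) \<le> x" "x \<le> 1"
  shows "Z_zeta_Q2_transformation T0 \<phi> (2 * x) T U k (\<lambda>t. t powr \<Delta>) (\<lambda>_. 1)"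
  unfolding Z_zeta_Q2_transformation_def
proof (intro allI impI conjI)
  fix \<alpha> \<beta> :: "nat \<Rightarrow> real"
  assume \<alpha>: "associated_points T0 \<phi> T U k (\<lambda>t. t powr \<Delta>) \<alpha>"
    and \<beta>: "associated_points_one T0 \<phi> T U k \<beta>"
  obtain d where d: "rev_iter T0 \<phi> k T < d" "d < rev_iter T0 \<phi> k (T + U)"
    "\<And>r. r \<in> {0..k} \<Longrightarrow> \<alpha> r = (\<phi> ^^ (k - r)) d"
    using \<alpha> by (auto simp: associated_points_def)
  obtain e where e: "rev_iter T0 \<phi> k T < e" "e < rev_iter T0 \<phi> k (T + U)"
    "\<And>r. r \<in> {1..k} \<Longrightarrow> \<beta> r = (\<phi> ^^ (k - r)) e"
    using \<beta> by (auto simp: associated_points_one_def)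
  have "rev_iter T0 \<phi> 0 T < \<alpha> 0 \<and> \<alpha> 0 < rev_iter T0 \<phi> 0 (T + U)"
    using iterate_between[of T "T + U" k d 0] d T U by simp
  then show \<alpha>0: "\<alpha> 0 \<in> {T<..<T + U}"
    by (simp add: rev_iter_def)
  define A :: real where "A = 2 ^ Suc m"
  have \<alpha>_bd: "\<alpha> r \<in> {T..A * T}" and \<beta>_bd: "\<beta> r \<in> {T..A * T}" if "r \<in> {1..k}" for r
    using associated_point_bounds[OF T(1) U k d(1,2), of r]
      associated_point_bounds[OF T(1) U k e(1,2), of r] d(3)[of r] e(3)[of r] that
    by (auto simp: A_def)

  \<comment> \<open>\<open>F = P * \<Prod>\<^sub>r q r\<close>, where every factor on the right has a small logarithm.\<close>
  define z where "z = (\<lambda>t. (cmod (riemann_zeta (Complex (1/2) t)))\<^sup>2)"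
  define w where "w = (\<lambda>t. (1 + \<eta> t) * ln t)"
  define q where "q = (\<lambda>r. w (\<alpha> r) / w (\<beta> r))"
  define P where "P = integral {T..T + U} (\<lambda>t. t powr \<Delta>) / (U * \<alpha> 0 powr \<Delta>)"
  have q: "q r > 0" "\<bar>ln (q r)\<bar> \<le> 4 * \<kappa> + ln A / ln T" if "r \<in> {1..k}" for r
    using quotient_of_ladder_weights[OF T(2) \<alpha>_bd[OF that] \<beta>_bd[OF that], of \<eta> \<kappa>]
      \<eta>[of "\<alpha> r"] \<eta>[of "\<beta> r"] \<alpha>_bd[OF that] \<beta>_bd[OF that] \<kappa>
    by (auto simp: q_def w_def)
  have P: "P > 0" "\<bar>ln P\<bar> \<le> \<bar>\<Delta>\<bar> * (U / T)"
    using abs_ln_mean_powr_le[of T U "\<alpha> 0" \<Delta>] T U \<alpha>0 by (auto simp: P_def)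
  have "U \<noteq> 0" "\<alpha> 0 powr \<Delta> \<noteq> 0"
    using U T \<alpha>0 by auto
  note quot = associated_products_quotient[OF \<alpha> \<beta> this]

  define F where "F = (\<Prod>r=1..k. (cmod (riemann_zeta (Complex (1/2) (\<alpha> r))
                           / riemann_zeta (Complex (1/2) (\<beta> r))))\<^sup>2)"
  have "F = (\<Prod>r=1..k. deriv \<phi> (\<alpha> r) / deriv \<phi> (\<beta> r) * q r)"
    unfolding F_def
  proof (rule prod.cong)
    fix r assume r: "r \<in> {1..k}"
    have "w t > 0" if "t \<ge> T" for t
      using \<eta>[OF that] \<kappa> T that by (auto simp: w_def)
    then have "w (\<alpha> r) > 0" "w (\<beta> r) > 0"
      using \<alpha>_bd[OF r] \<beta>_bd[OF r] by auto
    moreover have "deriv \<phi> (\<alpha> r) = z (\<alpha> r) / w (\<alpha> r)" "deriv \<phi> (\<beta> r) = z (\<beta> r) / w (\<beta> r)"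
      using deriv \<alpha>_bd[OF r] \<beta>_bd[OF r] by (auto simp: z_def w_def)
    ultimately show "(cmod (riemann_zeta (Complex (1/2) (\<alpha> r))
           / riemann_zeta (Complex (1/2) (\<beta> r))))\<^sup>2 = deriv \<phi> (\<alpha> r) / deriv \<phi> (\<beta> r) * q r"
      by (simp add: q_def z_def norm_divide power_divide)
  qed simp
  also have "\<dots> = (\<Prod>r=1..k. deriv \<phi> (\<alpha> r)) / (\<Prod>r=1..k. deriv \<phi> (\<beta> r)) * (\<Prod>r=1..k. q r)"
    by (simp only: prod.distrib prod_dividef)
  also have "\<dots> = P * (\<Prod>r=1..k. q r)"
    by (simp only: quot P_def)
  finally have F: "F = P * (\<Prod>r=1..k. q r)" .
  have prod_pos: "(\<Prod>r=1..k. q r) > 0"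
    using q(1) by (intro prod_pos) auto
  have q_nz: "q r \<noteq> 0" if "r \<in> {1..k}" for r
    using q(1)[OF that] by simp
  have "\<bar>ln (\<Prod>r=1..k. q r)\<bar> = \<bar>\<Sum>r=1..k. ln (q r)\<bar>"
    by (simp only: ln_prod[OF finite_atLeastAtMost q_nz])
  also have "\<dots> \<le> (\<Sum>r=1..k. \<bar>ln (q r)\<bar>)"
    by (rule sum_abs)
  also have "\<dots> \<le> (\<Sum>r=1..k. 4 * \<kappa> + ln A / ln T)"
    using q(2) by (intro sum_mono) auto
  also have "\<dots> = real k * (4 * \<kappa> + ln A / ln T)"
    by simp
  finally have "\<bar>ln (\<Prod>r=1..k. q r)\<bar> \<le> real k * (4 * \<kappa> + ln A / ln T)" .
  moreover have "ln F = ln P + ln (\<Prod>r=1..k. q r)"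
    unfolding F using P(1) prod_pos by (rule ln_mult_pos)
  ultimately have "\<bar>ln F\<bar> \<le> x"
    using P(2) x(1) unfolding A_def by linarith
  moreover have "F > 0"
    using P prod_pos F by simp
  ultimately have "\<bar>F - 1\<bar> \<le> 2 * x"
    using x(2) by (intro abs_minus_one_le_of_abs_ln_le)
  then show "\<exists>\<epsilon>. \<bar>\<epsilon>\<bar> \<le> 2 * x \<and>
     (\<Prod>r=1..k. (cmod (riemann_zeta (Complex (1/2) (\<alpha> r))
         / riemann_zeta (Complex (1/2) (\<beta> r))))\<^sup>2) = (1 + \<epsilon>) * 1"
    unfolding F_def by (intro exI[of _ "F - 1"]) (simp add: F_def)
qed

theorem theorem1:
  fixes \<phi>1 U0 :: "real \<Rightarrow> real" and T0 \<Delta> :: real and k0 :: nat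
  assumes ladder: "jacobs_ladder T0 \<phi>1"
    and ladder_C1: "\<phi>1 C1_differentiable_on {T0<..}"
    and ladder_mono: "strict_mono_on {T0<..} \<phi>1"
    and ladder_at_top: "filterlim \<phi>1 at_top at_top"
    and ladder_diff: "(\<lambda>t. t - \<phi>1 t) \<sim>[at_top] (\<lambda>t. (1 - euler_mascheroni) * (t / ln t))"
    and ladder_deriv: "\<exists>\<eta>. \<eta> \<in> O[at_top](\<lambda>t. ln (ln t) / ln t) \<and>
          (\<forall>\<^sub>F t in at_top.
             deriv \<phi>1 t = (cmod (riemann_zeta (Complex (1/2) t)))\<^sup>2 / ((1 + \<eta> t) * ln t))"
    and U0_pos: "\<forall>\<^sub>F T in at_top. U0 T > 0"
    and U0_small: "U0 \<in> o[at_top](\<lambda>T. T / ln T)"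
  shows "\<exists>C>0. \<exists>T1>0. \<forall>k\<in>{1..k0}. \<forall>T\<ge>T1. \<forall>U\<in>{0<..<U0 T}.
           Z_zeta_Q2_transformation T0 \<phi>1 (C * (ln (ln T) / ln T)) T U k
             (\<lambda>t. t powr \<Delta>) (\<lambda>_. 1)"
proof -
  obtain \<eta> where \<eta>: "\<eta> \<in> O[at_top](\<lambda>t. ln (ln t) / ln t)"
    and deriv: "\<forall>\<^sub>F t in at_top.
      deriv \<phi>1 t = (cmod (riemann_zeta (Complex (1/2) t)))\<^sup>2 / ((1 + \<eta> t) * ln t)"
    using ladder_deriv by blast
  obtain K where K: "K > 0"
    "\<forall>\<^sub>F t in at_top. norm (\<eta> t) \<le> K * norm (ln (ln t) / ln t)"
    using landau_o.bigE[OF \<eta>] by blast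
  obtain S where "reverse_ladder T0 S \<phi>1"
    using eventually_happens[OF reverse_ladder_eventually[OF ladder_C1 ladder_mono
          ladder_at_top ladder_diff]] by auto
  then interpret reverse_ladder T0 S \<phi>1 .

  define \<epsilon> :: "real \<Rightarrow> real" where "\<epsilon> = (\<lambda>T. ln (ln T) / ln T)"
  \<comment> \<open>\<open>B * \<epsilon> T\<close> bounds all logarithms together; the summand \<open>1\<close> makes \<open>B\<close> positive.\<close>
  define B where "B = \<bar>\<Delta>\<bar> + real k0 * (4 * K + ln (2 ^ Suc k0)) + 1"
  have ln2: "ln (2 ^ Suc k0 :: real) \<ge> 0"
    by (intro ln_ge_zero one_le_power) simp
  then have B: "B \<ge> 1"
    using K by (simp add: B_def del: power_Suc)
  have \<epsilon>_lim: "(\<epsilon> \<longlongrightarrow> 0) at_top"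
    unfolding \<epsilon>_def by real_asymp
  have K\<epsilon>: "\<forall>\<^sub>F T in at_top. K * \<epsilon> T < 1/2"
    by (rule order_tendstoD[OF tendsto_mult_right_zero[OF \<epsilon>_lim]]) simp
  have B\<epsilon>: "\<forall>\<^sub>F T in at_top. B * \<epsilon> T < 1"
    by (rule order_tendstoD[OF tendsto_mult_right_zero[OF \<epsilon>_lim]]) simp
  have U0: "\<forall>\<^sub>F T in at_top. norm (U0 T) \<le> 1 * norm (T / ln T)"
    using U0_small by (rule landau_o.smallD) simp

  have "\<forall>\<^sub>F T in at_top. \<forall>k\<in>{1..k0}. \<forall>U\<in>{0<..<U0 T}.
      Z_zeta_Q2_transformation T0 \<phi>1 (2 * B * \<epsilon> T) T U k (\<lambda>t. t powr \<Delta>) (\<lambda>_. 1)"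
    using eventually_all_ge_at_top[OF deriv] eventually_all_ge_at_top[OF K(2)] K\<epsilon> B\<epsilon> U0
      eventually_ge_at_top[of S] eventually_ge_at_top[of "exp (exp 1)"]
    \<comment> \<open>From \<open>exp (exp 1)\<close> on, \<open>ln ln T \<ge> 1\<close>, so \<open>1 / ln T \<le> \<epsilon> T\<close>, and \<open>\<epsilon>\<close> is decreasing,
      so the bound for \<open>\<eta>\<close> at \<open>T\<close> covers all later points.\<close>
  proof eventually_elim
    case (elim T)
    have lnT: "ln T \<ge> exp 1"
      using elim(7) by (metis exp_gt_zero less_le_trans ln_exp ln_le_cancel_iff)
    then have lnlnT: "ln (ln T) \<ge> 1"
      by (metis exp_gt_zero less_le_trans ln_exp ln_le_cancel_iff)
    have lnT1: "ln T \<ge> 1"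
      using lnT exp_ge_add_one_self[of 1] by linarith
    have T1: "T > 1"
      using lnT1 elim(7) by (smt (verit) exp_gt_zero ln_less_zero ln_one)
    have inv: "1 / ln T \<le> \<epsilon> T"
      using lnT1 lnlnT by (simp add: \<epsilon>_def divide_right_mono)
    have \<epsilon>0: "\<epsilon> T \<ge> 0"
      using lnT1 lnlnT by (simp add: \<epsilon>_def)
    have \<eta>_le: "\<bar>\<eta> t\<bar> \<le> K * \<epsilon> T" if t: "t \<ge> T" for t
    proof -
      have lnt: "ln t \<ge> ln T"
        using T1 t by simp
      have "\<bar>\<eta> t\<bar> \<le> K * \<bar>ln (ln t) / ln t\<bar>"
        using elim(2) t by auto
      also have "\<bar>ln (ln t) / ln t\<bar> = ln (ln t) / ln t"
        using lnt lnT1 by (intro abs_of_nonneg divide_nonneg_nonneg) auto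
      also have "\<dots> \<le> \<epsilon> T"
        unfolding \<epsilon>_def using lnT lnt by (rule ln_x_over_x_mono)
      finally show ?thesis
        using K by simp
    qed
    show ?case
    proof (intro ballI)
      fix k U
      assume kU: "k \<in> {1..k0}" "U \<in> {0<..<U0 T}"
      have "norm (T / ln T) = T / ln T"
        using T1 lnT1 by simp
      then have U: "0 < U" "U \<le> T / ln T"
        using elim(5) kU by auto
      have "T / ln T \<le> T"
        using T1 lnT1 by (simp add: divide_le_eq)
      with U have UT: "U \<le> T"
        by linarith
      have "U / T \<le> 1 / ln T"
        using U T1 lnT1 by (simp add: field_simps)
      then have "\<bar>\<Delta>\<bar> * (U / T) \<le> \<bar>\<Delta>\<bar> * \<epsilon> T"
        using inv by (intro mult_left_mono) auto
      moreover have "real k * (4 * (K * \<epsilon> T) + ln (2 ^ Suc k0) / ln T)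
          \<le> real k0 * (4 * (K * \<epsilon> T) + ln (2 ^ Suc k0) * \<epsilon> T)"
      proof (intro mult_mono add_left_mono)
        have "ln (2 ^ Suc k0) * (1 / ln T) \<le> ln (2 ^ Suc k0) * \<epsilon> T"
          using inv ln2 by (rule mult_left_mono)
        then show "ln (2 ^ Suc k0) / ln T \<le> ln (2 ^ Suc k0) * \<epsilon> T"
          by simp
      qed (use kU K \<epsilon>0 lnT1 ln2 in \<open>auto simp del: power_Suc\<close>)
      ultimately have "\<bar>\<Delta>\<bar> * (U / T) + real k * (4 * (K * \<epsilon> T) + ln (2 ^ Suc k0) / ln T)
          \<le> B * \<epsilon> T"
        using \<epsilon>0 unfolding B_def by (simp add: algebra_simps)
      then show "Z_zeta_Q2_transformation T0 \<phi>1 (2 * B * \<epsilon> T) T U k (\<lambda>t. t powr \<Delta>) (\<lambda>_. 1)"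
        using Z_zeta_Q2_transformation_powr[of T \<eta> "K * \<epsilon> T" U k k0 \<Delta> "B * \<epsilon> T"]
          elim kU T1 U UT \<eta>_le by (simp add: mult.assoc)
    qed
  qed
  then obtain T1 where T1: "\<And>T k U. T \<ge> T1 \<Longrightarrow> k \<in> {1..k0} \<Longrightarrow> U \<in> {0<..<U0 T} \<Longrightarrow>
      Z_zeta_Q2_transformation T0 \<phi>1 (2 * B * \<epsilon> T) T U k (\<lambda>t. t powr \<Delta>) (\<lambda>_. 1)"
    unfolding eventually_at_top_linorder by blast
  show ?thesis
    using B T1 by (intro exI[of _ "2 * B"] conjI exI[of _ "max T1 1"]) (auto simp: \<epsilon>_def)
qed

end
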